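(* Assume that $1\le q<\alpha<p\le\infty$ and that there exist a non-decreasing function $\varphi$ on $[0,\infty)$ and two constants $0<\mathfrak a\le\mathfrak b<\infty$ such that $$\mathfrak a\,\varphi(r)\le\mu(B(x,r))\le\mathfrak b\,\varphi(r),\qquad x\in X,\ r>0.$$ Then $(L^q,L^p)^\alpha(X)\setminus L^{\alpha,\infty}(X)\neq\emptyset$.
   Context: Setting. $(X,d,\mu)$ is a space of homogeneous type: $d$ is a quasi-metric on $X$ (with a constant $\kappa\ge 1$ such that $d(x,y)\le\kappa(d(x,z)+d(z,y))$ for all $x,y,z\in X$), and $\mu$ is a non-negative Borel measure such that, with $B(x,r)=\{y\in X: d(x,y)<r\}$, there is a constant $C$ with $0<\mu(B(x,2r))\le C\mu(B(x,r))<\infty$ for all $x\in X$, $r>0$. It is assumed moreover that all balls $B(x,r)$ are open for the $d$-topology, $(X,d)$ is separable, $\mu(X)=\infty$, and $B(x,R)\setminus B(x,r)\neq\emptyset$ for all $x\in X$ and $0<r<R<\infty$. Notation. $L_0(X)$ is the complex vector space of classes (modulo equality $\mu$-almost everywhere) of $\mu$-measurable complex-valued functions on $X$; $\|\cdot\|_q$ is the usual norm of $L^q(X)=L^q(X,\mu)$; $\chi_E$ is the characteristic function of $E$. For $f\in L_0(X)$ and $r>0$ (convention $1/\infty=0$), $${}_{r}\|f\|_{q,p,\alpha}=\left[\int_X\left(\mu(B(y,r))^{\frac1\alpha-\frac1p-\frac1q}\,\|f\chi_{B(y,r)}\|_q\right)^p d\mu(y)\right]^{1/p}\quad\text{if }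 p<\infty,$$ $${}_{r}\|f\|_{q,\infty,\alpha}=\sup_{y\in X}\mu(B(y,r))^{\frac1\alpha-\frac1q}\,\|f\chi_{B(y,r)}\|_q\quad\text{if } p=\infty.$$ Further $\|f\|_{q,p,\alpha}=\sup_{r>0}\ {}_{r}\|f\|_{q,p,\alpha}$ and $(L^q,L^p)^\alpha(X)=\{f\in L_0(X):\|f\|_{q,p,\alpha}<\infty\}$. $L^{\alpha,\infty}(X)$ is the Lorentz (weak Lebesgue) space of all $f\in L_0(X)$ with $\sup_{t>0}t^{1/\alpha}f^*(t)<\infty$, where $\lambda_f(s)=\mu(\{x:|f(x)|>s\})$, $f_*(t)=\inf\{s>0:\lambda_f(s)\le t\}$ and $f^*(t)=\frac1t\int_0^tf_*(u)\,du$; since $\alpha>1$, this is equivalent to $\sup_{s>0}s\,\lambda_f(s)^{1/\alpha}<\infty$. *)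

theory Defs
  imports "HOL-Analysis.Analysis"
begin

section \<open>Spaces of homogeneous type\<close>

text \<open>The underlying set \<open>X\<close> is the whole type \<open>'a\<close>. The library's balls and topologies belong to
  genuine metrics, so those of a quasi-metric \<open>d\<close> are defined here.\<close>

definition qball :: "('a \<Rightarrow> 'a \<Rightarrow> real) \<Rightarrow> 'a \<Rightarrow> real \<Rightarrow> 'a set" where
  "qball d x r = {y. d x y < r}"

definition qtopology :: "('a \<Rightarrow> 'a \<Rightarrow> real) \<Rightarrow> 'a topology" where
  "qtopology d = topology (\<lambda>U. \<forall>x\<in>U. \<exists>r>0. qball d x r \<subseteq> U)"

lemma openin_qtopology:
  "openin (qtopology d) U \<longleftrightarrow> (\<forall>x\<in>U. \<exists>r>0. qball d x r \<subseteq> U)"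
proof -
  have "istopology (\<lambda>U. \<forall>x\<in>U. \<exists>r>0. qball d x r \<subseteq> U)"
    unfolding istopology_def
  proof (intro conjI allI impI ballI)
    fix S T x
    assume S: "\<forall>x\<in>S. \<exists>r>0. qball d x r \<subseteq> S" and T: "\<forall>x\<in>T. \<exists>r>0. qball d x r \<subseteq> T"
      and x: "x \<in> S \<inter> T"
    from S T x obtain r s where "r > 0" "qball d x r \<subseteq> S" "s > 0" "qball d x s \<subseteq> T"
      by blast
    then have "min r s > 0 \<and> qball d x (min r s) \<subseteq> S \<inter> T"
      by (auto simp: qball_def)
    then show "\<exists>r>0. qball d x r \<subseteq> S \<inter> T" by blast
  next
    fix K x
    assume K: "\<forall>U\<in>K. \<forall>x\<in>U. \<exists>r>0. qball d x r \<subseteq> U" and x: "x \<in> \<Union>K"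
    then obtain U where U: "U \<in> K" "x \<in> U" by blast
    with K obtain r where "r > 0" "qball d x r \<subseteq> U" by blast
    with U show "\<exists>r>0. qball d x r \<subseteq> \<Union>K" by blast
  qed
  then show ?thesis
    by (simp add: qtopology_def topology_inverse')
qed

lemma topspace_qtopology [simp]: "topspace (qtopology d) = UNIV"
proof -
  have "openin (qtopology d) UNIV"
    unfolding openin_qtopology by (auto intro: exI[of _ 1])
  then show ?thesis using openin_subset by blast
qed

locale quasi_metric =
  fixes d :: "'a \<Rightarrow> 'a \<Rightarrow> real"
  assumes nonneg: "0 \<le> d x y"
    and zero_iff: "d x y = 0 \<longleftrightarrow> x = y"
    and sym: "d x y = d y x"
    and quasi_triangle: "\<exists>\<kappa>\<ge>1. \<forall>x y z. d x y \<le> \<kappa> * (d x z + d z y)"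

locale homogeneous_type_space = quasi_metric d
  for d :: "'a \<Rightarrow> 'a \<Rightarrow> real" +
  fixes M :: "'a measure"
  assumes sets_eq_borel: "sets M = sigma_sets UNIV {U. openin (qtopology d) U}"
    and doubling: "\<exists>C::real. \<forall>x. \<forall>r>0.
      0 < emeasure M (qball d x (2 * r)) \<and>
      emeasure M (qball d x (2 * r)) \<le> ennreal C * emeasure M (qball d x r) \<and>
      ennreal C * emeasure M (qball d x r) < \<infinity>"

locale standing_homogeneous_type_space = homogeneous_type_space +
  assumes balls_open: "openin (qtopology d) (qball d x r)"
    and separable: "separable_space (qtopology d)"
    and infinite_measure: "emeasure M UNIV = \<infinity>"
    and annuli_nonempty: "0 < r \<Longrightarrow> r < R \<Longrightarrow> qball d x R - qball d x r \<noteq> {}"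

section \<open>Function spaces\<close>

text \<open>All norms below take values in \<open>[0,\<infinity>]\<close>. The following power extends \<open>powr\<close> by
  \<open>\<infinity> powr s = \<infinity>\<close>; it is only used with \<open>s > 0\<close>.\<close>

definition ennreal_powr :: "ennreal \<Rightarrow> real \<Rightarrow> ennreal" where
  "ennreal_powr x s = (if x = \<infinity> then \<infinity> else ennreal (enn2real x powr s))"

definition Lq_norm :: "'a measure \<Rightarrow> real \<Rightarrow> ('a \<Rightarrow> complex) \<Rightarrow> ennreal" where
  "Lq_norm M q f = ennreal_powr (\<integral>\<^sup>+ x. ennreal (norm (f x) powr q) \<partial>M) (1 / q)"

text \<open>The weight \<open>\<mu>(B(y,r))\<close> is positive and finite in a space of homogeneous type, so its powers
  (of any sign) are taken in the reals. In \<open>ereal\<close>, \<open>1 / \<infinity> = 0\<close>, so for \<open>p = \<infinity>\<close> the exponent of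
  the weight is \<open>1 / \<alpha> - 1 / q\<close>.\<close>

definition local_term ::
  "('a \<Rightarrow> 'a \<Rightarrow> real) \<Rightarrow> 'a measure \<Rightarrow> real \<Rightarrow> ereal \<Rightarrow> real \<Rightarrow> real \<Rightarrow> ('a \<Rightarrow> complex) \<Rightarrow> 'a \<Rightarrow> ennreal"
where
  "local_term d M q p \<alpha> r f y =
     ennreal (measure M (qball d y r) powr (1 / \<alpha> - real_of_ereal (1 / p) - 1 / q)) *
     Lq_norm M q (\<lambda>x. f x * indicator (qball d y r) x)"

definition amalgam_norm_at ::
  "('a \<Rightarrow> 'a \<Rightarrow> real) \<Rightarrow> 'a measure \<Rightarrow> real \<Rightarrow> ereal \<Rightarrow> real \<Rightarrow> real \<Rightarrow> ('a \<Rightarrow> complex) \<Rightarrow> ennreal"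
where
  "amalgam_norm_at d M q p \<alpha> r f =
     (if p = \<infinity> then (SUP y. local_term d M q p \<alpha> r f y)
      else ennreal_powr
        (\<integral>\<^sup>+ y. ennreal_powr (local_term d M q p \<alpha> r f y) (real_of_ereal p) \<partial>M)
        (1 / real_of_ereal p))"

definition amalgam_norm ::
  "('a \<Rightarrow> 'a \<Rightarrow> real) \<Rightarrow> 'a measure \<Rightarrow> real \<Rightarrow> ereal \<Rightarrow> real \<Rightarrow> ('a \<Rightarrow> complex) \<Rightarrow> ennreal"
where
  "amalgam_norm d M q p \<alpha> f = (SUP r\<in>{0<..}. amalgam_norm_at d M q p \<alpha> r f)"

text \<open>As usual in the library, elements of \<open>L\<^sub>0(X)\<close> are given by measurable representatives; both
  spaces below are closed under modification on null sets.\<close>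

definition amalgam_space ::
  "('a \<Rightarrow> 'a \<Rightarrow> real) \<Rightarrow> 'a measure \<Rightarrow> real \<Rightarrow> ereal \<Rightarrow> real \<Rightarrow> ('a \<Rightarrow> complex) set"
where
  "amalgam_space d M q p \<alpha> = {f \<in> borel_measurable M. amalgam_norm d M q p \<alpha> f < \<infinity>}"

definition distribution_fun :: "'a measure \<Rightarrow> ('a \<Rightarrow> complex) \<Rightarrow> real \<Rightarrow> ennreal" where
  "distribution_fun M f s = emeasure M {x \<in> space M. norm (f x) > s}"

text \<open>\<open>rearrangement\<close> is \<open>f\<^sub>*\<close> and \<open>avg_rearrangement\<close> is its average \<open>f\<^sup>*\<close>. The infimum is taken in
  \<open>ennreal\<close>, so that \<open>f\<^sub>*(t) = \<infinity>\<close> if no \<open>s\<close> is admissible.\<close>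

definition rearrangement :: "'a measure \<Rightarrow> ('a \<Rightarrow> complex) \<Rightarrow> real \<Rightarrow> ennreal" where
  "rearrangement M f t = (INF s\<in>{s. s > 0 \<and> distribution_fun M f s \<le> ennreal t}. ennreal s)"

definition avg_rearrangement :: "'a measure \<Rightarrow> ('a \<Rightarrow> complex) \<Rightarrow> real \<Rightarrow> ennreal" where
  "avg_rearrangement M f t =
     ennreal (1 / t) * (\<integral>\<^sup>+ u\<in>{0<..<t}. rearrangement M f u \<partial>lborel)"

definition weak_Lebesgue_space :: "'a measure \<Rightarrow> real \<Rightarrow> ('a \<Rightarrow> complex) set" where
  "weak_Lebesgue_space M \<alpha> =
     {f \<in> borel_measurable M.
        (SUP t\<in>{0<..}. ennreal (t powr (1 / \<alpha>)) * avg_rearrangement M f t) < \<infinity>}"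

end

theory Submission
  imports Defs
begin

text \<open>
  Why the inclusion fails. The example is a sum of spikes
  \<open>f = \<Sum>i. c\<^sub>i \<chi>(B(x\<^sub>i,1))\<close> with \<open>c\<^sub>i = (i+1) powr - (1/\<beta>)\<close> for some \<open>\<alpha> < \<beta> < p\<close>, whose centres
  \<open>x\<^sub>i\<close> move apart extremely fast.

  All the spikes live on sets of comparable measure, so on them weak \<open>L\<^sup>\<alpha>\<close> amounts to weak
  \<open>\<ell>\<^sup>\<alpha>\<close>, and \<open>c\<close> is not in weak \<open>\<ell>\<^sup>\<alpha>\<close> because \<open>\<beta> > \<alpha>\<close>: the union of the first \<open>n+1\<close> balls has measure
  comparable to \<open>n+1\<close>, and \<open>(n+1) powr (1/\<alpha>) * c\<^sub>n\<close> tends to infinity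
  (\<open>not_in_weak_Lebesgue_space\<close>).

  The amalgam norm, in contrast, only asks for \<open>c \<in> \<ell>\<^sup>p\<close> as long as a ball \<open>B(y,r)\<close> rarely meets
  more than one spike. If the ball meets \<open>N\<close> spikes, of which \<open>c\<^sub>i\<close> is the highest, then the local
  \<open>L\<^sup>q\<close> norm is at most a constant times \<open>c\<^sub>i (N \<phi>(min r 1)) powr (1/q)\<close>. The weight is of order
  \<open>\<phi>(r) powr (1/\<alpha> - 1/p - 1/q)\<close>, and integration over \<open>y\<close> will cost \<open>\<phi>(r) powr (1/p)\<close>. For \<open>r \<ge> 1\<close>
  this leaves room for the factor \<open>N powr (1/q)\<close> exactly when \<open>N\<close> is at most of order \<open>\<phi>(r) powr (1 - q/\<alpha>)\<close>. This exponent is positive since \<open>q < \<alpha>\<close>, and \<open>\<phi>\<close> is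
  unbounded since \<open>X\<close> has infinite measure, so the centres can be chosen recursively with this
  property (\<open>exists_sparse_sequence\<close>, \<open>card_near\<close>); a point far away from finitely many given ones
  exists because finitely many balls cannot cover a set of infinite measure. The \<open>p\<close>-th power of
  \<open>c\<^sub>i\<close> is then estimated by the sum of \<open>c\<^sub>i\<^sup>p\<close> over all spikes near \<open>y\<close>, and integration over
  \<open>y\<close> produces a factor of order \<open>\<phi>(max r 1)\<close>, by doubling. For \<open>r < 1\<close> what remains of the powers of \<open>\<phi>(r)\<close> is \<open>\<phi>(r) powr (1/\<alpha> - 1/p)\<close>, which
  is bounded because \<open>\<alpha> < p\<close>. The balance of the powers of \<open>\<phi>\<close> is \<open>scale_bounded\<close>.
\<close>

section \<open>Power estimates for extended norms\<close>

lemma ennreal_powr_ennreal: "0 \<le> v \<Longrightarrow> ennreal_powr (ennreal v) s = ennreal (v powr s)"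
  by (simp add: ennreal_powr_def)

lemma ennreal_powr_mono:
  assumes "x \<le> y" "0 < s"
  shows "ennreal_powr x s \<le> ennreal_powr y s"
proof (cases "y = \<infinity>")
  case False
  then have "x \<noteq> \<infinity>" using assms(1) by (auto simp: top_unique)
  have "enn2real x \<le> enn2real y"
    using assms(1) False by (intro enn2real_mono) (auto simp: top.not_eq_extremum)
  then show ?thesis
    using False \<open>x \<noteq> \<infinity>\<close> assms(2)
    by (auto simp: ennreal_powr_def intro!: ennreal_leI powr_mono2)
qed (simp add: ennreal_powr_def)

lemma Lq_norm_le:
  assumes q: "0 < q" and E: "E \<in> sets M" "emeasure M E \<le> ennreal v" and "0 \<le> v" "0 \<le> m"
    and bound: "\<And>x. x \<in> E \<Longrightarrow> norm (f x) \<le> m" and off: "\<And>x. x \<notin> E \<Longrightarrow> f x = 0"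
  shows "Lq_norm M q f \<le> ennreal (m * v powr (1 / q))"
proof -
  have "(\<integral>\<^sup>+ x. ennreal (norm (f x) powr q) \<partial>M) \<le> (\<integral>\<^sup>+ x. ennreal (m powr q) * indicator E x \<partial>M)"
  proof (intro nn_integral_mono)
    fix x
    show "ennreal (norm (f x) powr q) \<le> ennreal (m powr q) * indicator E x"
      using bound[of x] off[of x] q
      by (cases "x \<in> E") (auto intro!: ennreal_leI powr_mono2)
  qed
  also have "\<dots> = ennreal (m powr q) * emeasure M E"
    using E by (simp add: nn_integral_cmult_indicator)
  also have "\<dots> \<le> ennreal (m powr q) * ennreal v"
    using E by (intro mult_left_mono) auto
  also have "\<dots> = ennreal (m powr q * v)"
    using assms by (simp add: ennreal_mult)
  finally have "Lq_norm M q f \<le> ennreal_powr (ennreal (m powr q * v)) (1 / q)"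
    unfolding Lq_norm_def using q by (intro ennreal_powr_mono) auto
  also have "\<dots> = ennreal (m * v powr (1 / q))"
    using assms by (simp add: ennreal_powr_ennreal powr_mult powr_powr)
  finally show ?thesis .
qed

section \<open>Leaving the weak Lebesgue space\<close>

text \<open>Below the level \<open>c n\<close> the distribution function is at least \<open>(n+1) m\<close>, as the first \<open>n+1\<close>
  sets contribute fully. Hence the rearrangement is at least \<open>c n\<close> on the whole interval
  \<open>(0, (n+1) m)\<close>, and so is its average at the right end point.\<close>

lemma not_in_weak_Lebesgue_space:
  fixes B :: "nat \<Rightarrow> 'a set" and f :: "'a \<Rightarrow> complex"
  assumes disj: "disjoint_family B" and meas: "\<And>i. B i \<in> sets M"
    and big: "\<And>i. ennreal m \<le> emeasure M (B i)" and "0 < m"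
    and c: "decseq c" "\<And>i. 0 \<le> c i"
    and f: "\<And>i x. x \<in> B i \<Longrightarrow> c i \<le> norm (f x)" "f \<in> borel_measurable M"
    and unbounded: "\<And>Z. \<exists>n. Z < (real (Suc n) * m) powr (1 / \<alpha>) * c n"
  shows "f \<notin> weak_Lebesgue_space M \<alpha>"
proof
  assume "f \<in> weak_Lebesgue_space M \<alpha>"
  then have fin: "(SUP t\<in>{0<..}. ennreal (t powr (1 / \<alpha>)) * avg_rearrangement M f t) < \<infinity>"
    by (simp add: weak_Lebesgue_space_def)
  have rearr: "ennreal (c n) \<le> rearrangement M f u" if u: "0 < u" "u < real (Suc n) * m" for n u
    unfolding rearrangement_def
  proof (rule INF_greatest)
    fix s assume s: "s \<in> {s. 0 < s \<and> distribution_fun M f s \<le> ennreal u}"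
    have "c n \<le> s"
    proof (rule ccontr)
      assume "\<not> c n \<le> s"
      have "(\<Union>i\<in>{..n}. B i) \<subseteq> {x \<in> space M. s < norm (f x)}"
      proof
        fix x assume "x \<in> (\<Union>i\<in>{..n}. B i)"
        then obtain i where i: "i \<le> n" "x \<in> B i" by blast
        then have "s < c i" using \<open>\<not> c n \<le> s\<close> decseqD[OF c(1) i(1)] by linarith
        moreover have "x \<in> space M" using i meas sets.sets_into_space by blast
        ultimately show "x \<in> {x \<in> space M. s < norm (f x)}"
          using f(1)[OF i(2)] by simp
      qed
      then have "emeasure M (\<Union>i\<in>{..n}. B i) \<le> distribution_fun M f s"
        unfolding distribution_fun_def using f(2) by (intro emeasure_mono) auto
      moreover have "emeasure M (\<Union>i\<in>{..n}. B i) = (\<Sum>i\<in>{..n}. emeasure M (B i))"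
        using disj meas by (intro sum_emeasure[symmetric])
          (auto simp: disjoint_family_on_def)
      moreover have "(\<Sum>i\<in>{..n}. ennreal m) \<le> (\<Sum>i\<in>{..n}. emeasure M (B i))"
        using big by (intro sum_mono)
      moreover have "(\<Sum>i\<in>{..n}. ennreal m) = ennreal (real (Suc n) * m)"
        using \<open>0 < m\<close> by (simp add: ennreal_mult' ennreal_of_nat_eq_real_of_nat del: of_nat_Suc)
      ultimately have "ennreal (real (Suc n) * m) \<le> ennreal u"
        using s by (metis (no_types, lifting) mem_Collect_eq order_trans)
      then show False using u by (simp add: ennreal_le_iff)
    qed
    then show "ennreal (c n) \<le> ennreal s" by (rule ennreal_leI)
  qed
  have avg: "ennreal (c n) \<le> avg_rearrangement M f t" if t: "t = real (Suc n) * m" for n t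
  proof -
    have "0 < t" using t \<open>0 < m\<close> by simp
    have "ennreal (c n) = ennreal (1 / t) * (ennreal (c n) * ennreal t)"
      using \<open>0 < t\<close> c(2)[of n] by (simp add: ennreal_mult[symmetric])
    also have "ennreal (c n) * ennreal t = (\<integral>\<^sup>+ u\<in>{0<..<t}. ennreal (c n) \<partial>lborel)"
      using \<open>0 < t\<close> by (simp add: nn_integral_cmult_indicator)
    also have "\<dots> \<le> (\<integral>\<^sup>+ u\<in>{0<..<t}. rearrangement M f u \<partial>lborel)"
      using rearr t by (intro nn_integral_mono) (auto simp: indicator_def)
    finally show ?thesis
      by (simp add: avg_rearrangement_def mult_left_mono)
  qed
  obtain Z where Z: "0 \<le> Z"
    "(SUP t\<in>{0<..}. ennreal (t powr (1 / \<alpha>)) * avg_rearrangement M f t) = ennreal Z"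
    using fin by (cases "SUP t\<in>{0<..}. ennreal (t powr (1 / \<alpha>)) * avg_rearrangement M f t") auto
  obtain n where n: "Z < (real (Suc n) * m) powr (1 / \<alpha>) * c n"
    using unbounded by blast
  define t where "t = real (Suc n) * m"
  have "0 < t" using \<open>0 < m\<close> by (simp add: t_def)
  have "ennreal (t powr (1 / \<alpha>) * c n) = ennreal (t powr (1 / \<alpha>)) * ennreal (c n)"
    using c(2) by (simp add: ennreal_mult)
  also have "\<dots> \<le> ennreal (t powr (1 / \<alpha>)) * avg_rearrangement M f t"
    using avg[OF t_def] by (intro mult_left_mono) auto
  also have "\<dots> \<le> ennreal Z"
    unfolding Z(2)[symmetric] using \<open>0 < t\<close> by (intro SUP_upper) auto
  finally show False
    using n Z(1) by (simp add: t_def ennreal_le_iff)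
qed

section \<open>Spaces with balls of uniformly comparable measure\<close>

locale uniform_ball_measure = standing_homogeneous_type_space d M
  for d :: "'a \<Rightarrow> 'a \<Rightarrow> real" and M :: "'a measure" +
  fixes \<phi> :: "real \<Rightarrow> real" and a b :: real
  assumes phi_mono: "mono_on {0..} \<phi>"
    and a_pos: "0 < a" and a_le_b: "a \<le> b"
    and phi_bounds: "\<And>x r. 0 < r \<Longrightarrow>
      a * \<phi> r \<le> measure M (qball d x r) \<and> measure M (qball d x r) \<le> b * \<phi> r"
begin

lemma space_M: "space M = UNIV"
proof -
  have "UNIV \<in> sets M"
    unfolding sets_eq_borel using openin_topspace[of "qtopology d"]
    by (intro sigma_sets.Basic) simp
  then show ?thesis using sets.sets_into_space by blast
qed

lemma ball_measurable [measurable]: "qball d x r \<in> sets M"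
  unfolding sets_eq_borel using balls_open by (intro sigma_sets.Basic) simp

lemma doubling_constant:
  obtains C :: real where "0 < C" and "\<And>x r. 0 < r \<Longrightarrow> 0 < emeasure M (qball d x (2 * r)) \<and>
      emeasure M (qball d x (2 * r)) \<le> ennreal C * emeasure M (qball d x r) \<and>
      ennreal C * emeasure M (qball d x r) < \<infinity>"
proof -
  obtain C :: real where C: "\<And>x r. 0 < r \<Longrightarrow> 0 < emeasure M (qball d x (2 * r)) \<and>
      emeasure M (qball d x (2 * r)) \<le> ennreal C * emeasure M (qball d x r) \<and>
      ennreal C * emeasure M (qball d x r) < \<infinity>"
    using doubling by blast
  have "0 < ennreal C" using C[of 1 undefined] by (auto simp: zero_less_iff_neq_zero)
  then show thesis using that[of C] C by simp
qed

lemma ball_emeasure: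
  assumes "0 < r"
  shows "emeasure M (qball d x r) = ennreal (measure M (qball d x r))"
    and "0 < measure M (qball d x r)"
proof -
  obtain C :: real where "0 < C" and C: "\<And>x r. 0 < r \<Longrightarrow> 0 < emeasure M (qball d x (2 * r)) \<and>
      emeasure M (qball d x (2 * r)) \<le> ennreal C * emeasure M (qball d x r) \<and>
      ennreal C * emeasure M (qball d x r) < \<infinity>"
    by (rule doubling_constant) blast
  have fin: "emeasure M (qball d x r) < \<infinity>"
    using C[OF assms, of x] \<open>0 < C\<close> by (auto simp: ennreal_mult_less_top)
  then show eq: "emeasure M (qball d x r) = ennreal (measure M (qball d x r))"
    by (simp add: emeasure_eq_ennreal_measure less_top)
  have "0 < emeasure M (qball d x r)" using C[of "r / 2" x] assms by simp
  then show "0 < measure M (qball d x r)" using eq by simp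
qed

lemma b_pos: "0 < b"
  using a_pos a_le_b by simp

lemma phi_pos:
  assumes "0 < r" shows "0 < \<phi> r"
proof -
  have "0 < b * \<phi> r"
    using phi_bounds[OF assms, of undefined] ball_emeasure(2)[OF assms, of undefined] by linarith
  then show ?thesis using b_pos by (simp add: zero_less_mult_iff)
qed

lemma phi_le: "0 \<le> r \<Longrightarrow> r \<le> s \<Longrightarrow> \<phi> r \<le> \<phi> s"
  using phi_mono by (auto simp: mono_on_def)

lemma ball_emeasure_le: "0 < r \<Longrightarrow> emeasure M (qball d x r) \<le> ennreal (b * \<phi> r)"
  using phi_bounds[of r x] by (simp add: ball_emeasure ennreal_leI)

text \<open>Otherwise the balls around a fixed point would exhaust \<open>X\<close> with bounded measures, and
  continuity from below would make \<open>\<mu>(X)\<close> finite.\<close>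

lemma phi_unbounded: "\<exists>T\<ge>1. N \<le> \<phi> T"
proof (rule ccontr)
  assume "\<not> ?thesis"
  then have small: "\<phi> T < N" if "1 \<le> T" for T using that by force
  define A where "A n = qball d undefined (real (Suc n))" for n
  have "range A \<subseteq> sets M" by (auto simp: A_def)
  moreover have "incseq A" by (auto simp: A_def incseq_def qball_def)
  ultimately have "(SUP n. emeasure M (A n)) = emeasure M (\<Union>n. A n)"
    by (rule SUP_emeasure_incseq)
  moreover have "(\<Union>n. A n) = UNIV"
  proof -
    have "\<exists>n. d undefined y < real (Suc n)" for y
    proof -
      obtain n where "d undefined y < real n" using reals_Archimedean2 by blast
      then show ?thesis by (intro exI[of _ n]) simp
    qed
    then show ?thesis by (auto simp: A_def qball_def)
  qed
  moreover have "(SUP n. emeasure M (A n)) \<le> ennreal (b * N)"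
  proof (rule SUP_least)
    fix n
    have "emeasure M (A n) \<le> ennreal (b * \<phi> (real (Suc n)))"
      unfolding A_def by (rule ball_emeasure_le) simp
    also have "\<dots> \<le> ennreal (b * N)"
      using small[of "real (Suc n)"] b_pos by (intro ennreal_leI mult_left_mono) auto
    finally show "emeasure M (A n) \<le> ennreal (b * N)" .
  qed
  ultimately have "emeasure M UNIV \<le> ennreal (b * N)" by metis
  then show False using infinite_measure by (simp add: top_unique)
qed

lemma dilated_ball_measure: "\<exists>D>0. \<forall>x r. 0 < r \<longrightarrow> measure M (qball d x (L * r)) \<le> D * \<phi> r"
proof -
  obtain C :: real where "0 < C" and C: "\<And>x r. 0 < r \<Longrightarrow> 0 < emeasure M (qball d x (2 * r)) \<and>
      emeasure M (qball d x (2 * r)) \<le> ennreal C * emeasure M (qball d x r) \<and>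
      ennreal C * emeasure M (qball d x r) < \<infinity>"
    by (rule doubling_constant) blast
  have dbl: "measure M (qball d x (2 * r)) \<le> C * measure M (qball d x r)" if "0 < r" for x r
    using C[OF that, of x] that \<open>0 < C\<close> ball_emeasure(1)[of r x] ball_emeasure(1)[of "2 * r" x]
    by (simp add: ennreal_mult[symmetric])
  have iter: "measure M (qball d x (2 ^ k * r)) \<le> C ^ k * measure M (qball d x r)"
    if "0 < r" for x r and k :: nat
  proof (induction k)
    case (Suc k)
    have "measure M (qball d x (2 ^ Suc k * r)) \<le> C * measure M (qball d x (2 ^ k * r))"
      using dbl[of "2 ^ k * r" x] that by (simp add: mult.assoc)
    also have "\<dots> \<le> C * (C ^ k * measure M (qball d x r))"
      using Suc \<open>0 < C\<close> by (intro mult_left_mono) auto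
    finally show ?case by (simp add: mult.assoc)
  qed simp
  obtain k where k: "L < 2 ^ k" using real_arch_pow[of 2 L] by auto
  show ?thesis
  proof (intro exI[of _ "C ^ k * b"] conjI allI impI)
    show "0 < C ^ k * b" using \<open>0 < C\<close> b_pos by simp
    fix x r assume r: "0 < (r::real)"
    have "measure M (qball d x (L * r)) \<le> measure M (qball d x (2 ^ k * r))"
    proof (rule measure_mono_fmeasurable)
      have "L * r \<le> 2 ^ k * r" using k r by simp
      then show "qball d x (L * r) \<subseteq> qball d x (2 ^ k * r)" by (auto simp: qball_def)
      show "qball d x (2 ^ k * r) \<in> fmeasurable M"
        using r ball_emeasure(1)[of "2 ^ k * r" x] by (auto simp: fmeasurable_def)
    qed auto
    also have "\<dots> \<le> C ^ k * measure M (qball d x r)" using iter[OF r] .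
    also have "\<dots> \<le> C ^ k * (b * \<phi> r)"
      using phi_bounds[OF r, of x] \<open>0 < C\<close> by (intro mult_left_mono) auto
    finally show "measure M (qball d x (L * r)) \<le> C ^ k * b * \<phi> r" by (simp add: mult.assoc)
  qed
qed

text \<open>Finitely many balls have finite total measure, so they leave points uncovered. Finiteness
  is known for positive radii, whence the radius \<open>max R 1\<close>.\<close>

lemma exists_far_point:
  assumes "finite F" shows "\<exists>z. \<forall>y\<in>F. R \<le> d y z"
proof (rule ccontr)
  assume "\<not> ?thesis"
  then have "\<exists>y\<in>F. d y z < R" for z by (meson not_le)
  then have "UNIV \<subseteq> (\<Union>y\<in>F. qball d y (max R 1))"
    by (auto simp: qball_def less_max_iff_disj)
  then have "emeasure M UNIV \<le> emeasure M (\<Union>y\<in>F. qball d y (max R 1))"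
    using assms by (intro emeasure_mono) auto
  also have "\<dots> \<le> (\<Sum>y\<in>F. emeasure M (qball d y (max R 1)))"
    using assms by (intro emeasure_subadditive_finite) auto
  also have "\<dots> < \<infinity>"
    using assms by (auto simp: ball_emeasure less_top[symmetric])
  finally show False using infinite_measure by simp
qed

lemma exists_sparse_sequence: "\<exists>x :: nat \<Rightarrow> 'a. \<forall>j. \<forall>i<j. R j \<le> d (x i) (x j)"
proof (rule dependent_wellorder_choice)
  show "\<exists>z. \<forall>i<j. R j \<le> d (x i) z" for j :: nat and x :: "nat \<Rightarrow> 'a"
    using exists_far_point[of "x ` {..<j}" "R j"] by auto
qed auto

end

section \<open>Sparse sums of unit balls\<close>

text \<open>The factor \<open>4 * \<kappa>\<^sup>2\<close> is what two applications of the quasi-triangle inequality cost: two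
  centres within \<open>2 * \<kappa> * s\<close> of a common point are less than \<open>4 * \<kappa>\<^sup>2 * s\<close> apart. Thus the \<open>j\<close>-th centre
  can share a ball of scale \<open>s\<close> with an earlier one only if \<open>s > T j\<close>, when \<open>\<phi> s\<close> is already so
  large that \<open>j + 1\<close> spikes are harmless.\<close>

locale sparse_centres = uniform_ball_measure d M \<phi> a b
  for d :: "'a \<Rightarrow> 'a \<Rightarrow> real" and M :: "'a measure" and \<phi> :: "real \<Rightarrow> real" and a b :: real +
  fixes \<kappa> q \<alpha> :: real and T :: "nat \<Rightarrow> real" and x :: "nat \<Rightarrow> 'a"
  assumes kappa: "1 \<le> \<kappa>" "\<And>u v w. d u v \<le> \<kappa> * (d u w + d w v)"
    and q_less: "0 < q" "q < \<alpha>"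
    and T_ge: "\<And>j. 1 \<le> T j" "\<And>j. real (Suc j) \<le> \<phi> (T j) powr (1 - q / \<alpha>)"
    and sparse: "\<And>i j. i < j \<Longrightarrow> 4 * \<kappa>\<^sup>2 * T j \<le> d (x i) (x j)"
begin

text \<open>For \<open>s = max r 1\<close>, all unit balls around centres that meet \<open>B(y,r)\<close> are among these: the
  quasi-triangle inequality gives \<open>d (x i) y < \<kappa> * (1 + r)\<close>.\<close>

definition near :: "real \<Rightarrow> 'a \<Rightarrow> nat set" where
  "near s y = {i. d (x i) y < 2 * \<kappa> * s}"

definition overlap :: real where
  "overlap = 1 + \<phi> 1 powr - (1 - q / \<alpha>)"

lemma exponent_pos: "0 < 1 - q / \<alpha>"
  using q_less by simp

text \<open>Every index near \<open>y\<close> other than the least one is, by sparseness, smaller than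
  \<open>\<phi> s powr (1 - q / \<alpha>)\<close>. The least index itself may be arbitrarily large; it accounts for the
  summand \<open>1\<close>, which \<open>overlap\<close> absorbs.\<close>

lemma card_near:
  assumes s: "1 \<le> s"
  shows "finite (near s y)" "real (card (near s y)) \<le> overlap * \<phi> s powr (1 - q / \<alpha>)"
proof -
  define z where "z = \<phi> s powr (1 - q / \<alpha>)"
  have later: "real (Suc j) \<le> z" if "i \<in> near s y" "j \<in> near s y" "i < j" for i j
  proof -
    have "4 * \<kappa>\<^sup>2 * T j \<le> d (x i) (x j)" using sparse that(3) .
    also have "\<dots> \<le> \<kappa> * (d (x i) y + d y (x j))" by (rule kappa(2))
    also have "\<dots> \<le> \<kappa> * (2 * \<kappa> * s + 2 * \<kappa> * s)"
      using that(1,2) kappa(1) by (intro mult_left_mono) (auto simp: near_def sym[of y])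
    also have "\<dots> = 4 * \<kappa>\<^sup>2 * s" by (simp add: power2_eq_square)
    finally have "T j \<le> s" using kappa(1) by simp
    then have "\<phi> (T j) \<le> \<phi> s" using T_ge(1)[of j] by (intro phi_le) auto
    then have "\<phi> (T j) powr (1 - q / \<alpha>) \<le> z"
      unfolding z_def using exponent_pos phi_pos[of "T j"] T_ge(1)[of j]
      by (intro powr_mono2) auto
    with T_ge(2)[of j] show ?thesis by linarith
  qed
  define i0 where "i0 = (LEAST i. i \<in> near s y)"
  have "0 \<le> z" by (simp add: z_def)
  have sub: "near s y \<subseteq> insert i0 {..<nat \<lfloor>z\<rfloor>}"
  proof
    fix j assume j: "j \<in> near s y"
    have "i0 \<le> j" "i0 \<in> near s y" unfolding i0_def using j by (auto intro: Least_le LeastI)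
    then show "j \<in> insert i0 {..<nat \<lfloor>z\<rfloor>}"
      using later[of i0 j] j by (cases "i0 = j") (auto simp: Suc_le_eq[symmetric] le_nat_floor)
  qed
  then show "finite (near s y)" by (rule finite_subset) simp
  have "card (near s y) \<le> card (insert i0 {..<nat \<lfloor>z\<rfloor>})" using sub by (intro card_mono) auto
  also have "\<dots> \<le> 1 + nat \<lfloor>z\<rfloor>" by (simp add: card_insert_if)
  finally have "real (card (near s y)) \<le> 1 + z" using \<open>0 \<le> z\<close> by linarith
  also have "\<dots> \<le> \<phi> 1 powr - (1 - q / \<alpha>) * z + z"
  proof -
    \<comment> \<open>Since \<open>\<phi> 1 \<le> \<phi> s\<close>, a multiple of \<open>z\<close> that does not depend on \<open>s\<close> dominates \<open>1\<close>.\<close>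
    have "\<phi> 1 powr (1 - q / \<alpha>) \<le> z"
      unfolding z_def using s exponent_pos phi_pos[of 1] phi_le[of 1 s] by (intro powr_mono2) auto
    then have "\<phi> 1 powr - (1 - q / \<alpha>) * \<phi> 1 powr (1 - q / \<alpha>) \<le> \<phi> 1 powr - (1 - q / \<alpha>) * z"
      by (intro mult_left_mono) auto
    then show ?thesis using phi_pos[of 1] by (simp add: powr_add[symmetric])
  qed
  finally show "real (card (near s y)) \<le> overlap * \<phi> s powr (1 - q / \<alpha>)"
    by (simp add: overlap_def z_def algebra_simps)
qed

lemma disjoint_unit_balls: "disjoint_family (\<lambda>i. qball d (x i) 1)"
proof -
  have "qball d (x i) 1 \<inter> qball d (x j) 1 = {}" if "i < j" for i j
  proof (rule ccontr)
    assume "qball d (x i) 1 \<inter> qball d (x j) 1 \<noteq> {}"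
    then obtain y where y: "d (x i) y < 1" "d (x j) y < 1" by (auto simp: qball_def)
    have "d (x i) (x j) \<le> \<kappa> * (d (x i) y + d y (x j))" by (rule kappa(2))
    also have "\<dots> < \<kappa> * 2" using y kappa(1) by (intro mult_strict_left_mono) (auto simp: sym[of y])
    also have "\<dots> \<le> 4 * \<kappa>\<^sup>2 * T j"
    proof -
      have "\<kappa> * 1 * 1 \<le> \<kappa> * \<kappa> * T j"
        using kappa(1) T_ge(1)[of j] by (intro mult_mono) auto
      then show ?thesis using kappa(1) by (simp add: power2_eq_square)
    qed
    finally show False using sparse[OF that] by simp
  qed
  then show ?thesis
    unfolding disjoint_family_on_def by (metis Int_commute linorder_neqE_nat)
qed

definition spikes :: "(nat \<Rightarrow> real) \<Rightarrow> 'a \<Rightarrow> complex" where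
  "spikes c y = complex_of_real (\<Sum>i. c i * indicator (qball d (x i) 1) y)"

lemma spikes_measurable: "spikes c \<in> borel_measurable M"
  unfolding spikes_def by measurable

lemma spikes_on_ball:
  assumes "y \<in> qball d (x i) 1" shows "spikes c y = complex_of_real (c i)"
proof -
  have "c j * indicator (qball d (x j) 1) y = (0::real)" if "j \<noteq> i" for j
    using disjoint_unit_balls assms that by (auto simp: disjoint_family_on_def indicator_def)
  then have "(\<Sum>j. c j * indicator (qball d (x j) 1) y)
      = (\<Sum>j\<in>{i}. c j * indicator (qball d (x j) 1) y)"
    by (intro suminf_finite) auto
  then show ?thesis using assms by (simp add: spikes_def)
qed

lemma spikes_off_balls: "(\<And>i. y \<notin> qball d (x i) 1) \<Longrightarrow> spikes c y = 0"
  by (simp add: spikes_def)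

text \<open>A bound for \<open>local_term\<close> relative to the height of the highest spike near \<open>y\<close>: the
  weight, times the \<open>q\<close>-th root of the measure of the part of \<open>B(y,r)\<close> covered by spikes. Each of the
  spikes meets the ball in measure at most \<open>b * \<phi> (min r 1)\<close>, being contained in a ball of radius
  \<open>1\<close> and one of radius \<open>r\<close>. The parameter \<open>\<theta>\<close> stands for \<open>1 / p\<close>, so that \<open>p = \<infinity>\<close> is included
  as \<open>\<theta> = 0\<close>.\<close>

definition scale :: "real \<Rightarrow> real \<Rightarrow> real" where
  "scale \<theta> r = (a * \<phi> r) powr (1 / \<alpha> - \<theta> - 1 / q) *
     (overlap * \<phi> (max r 1) powr (1 - q / \<alpha>) * (b * \<phi> (min r 1))) powr (1 / q)"

lemma inverse_exponents: "1 / \<alpha> < 1 / q"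
  using q_less by (simp add: divide_strict_left_mono)

lemma overlap_pos: "0 < overlap"
  by (simp add: overlap_def add_pos_nonneg)

lemma local_term_le:
  assumes r: "0 < r" and c: "\<And>i. 0 \<le> c i" and m: "0 \<le> m" "\<And>i. i \<in> near (max r 1) y \<Longrightarrow> c i \<le> m"
    and \<theta>: "0 \<le> real_of_ereal (1 / p)"
  shows "local_term d M q p \<alpha> r (spikes c) y \<le> ennreal (scale (real_of_ereal (1 / p)) r * m)"
proof -
  define s t where "s = max r 1" and "t = min r 1"
  define v where "v = overlap * \<phi> s powr (1 - q / \<alpha>) * (b * \<phi> t)"
  define E where "E = (\<Union>i\<in>near s y. qball d (x i) 1 \<inter> qball d y r)"
  have st: "0 < t" "1 \<le> s" using r by (auto simp: s_def t_def)
  have fin: "finite (near s y)" using card_near st by blast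
  have met: "i \<in> near s y" if "u \<in> qball d (x i) 1" "u \<in> qball d y r" for u i
  proof -
    have "d (x i) y \<le> \<kappa> * (d (x i) u + d u y)" by (rule kappa(2))
    also have "\<dots> < \<kappa> * (s + s)"
      using that kappa(1) by (intro mult_strict_left_mono) (auto simp: s_def qball_def sym[of u])
    finally show ?thesis by (simp add: near_def)
  qed
  have "Lq_norm M q (\<lambda>u. spikes c u * indicator (qball d y r) u) \<le> ennreal (m * v powr (1 / q))"
  proof (rule Lq_norm_le)
    show "E \<in> sets M" unfolding E_def using fin by auto
    have "emeasure M E \<le> (\<Sum>i\<in>near s y. emeasure M (qball d (x i) 1 \<inter> qball d y r))"
      unfolding E_def using fin by (intro emeasure_subadditive_finite) auto
    also have "\<dots> \<le> (\<Sum>i\<in>near s y. ennreal (b * \<phi> t))"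
    proof (intro sum_mono)
      fix i
      have "emeasure M (qball d (x i) 1 \<inter> qball d y r) \<le> emeasure M (if r \<le> 1 then qball d y r else qball d (x i) 1)"
        by (intro emeasure_mono) auto
      also have "\<dots> \<le> ennreal (b * \<phi> t)"
        using r ball_emeasure_le[of r y] ball_emeasure_le[of 1 "x i"] by (auto simp: t_def min_def)
      finally show "emeasure M (qball d (x i) 1 \<inter> qball d y r) \<le> ennreal (b * \<phi> t)" .
    qed
    also have "\<dots> = ennreal (real (card (near s y)) * (b * \<phi> t))"
      by (simp add: ennreal_mult' ennreal_of_nat_eq_real_of_nat)
    also have "\<dots> \<le> ennreal v"
      unfolding v_def using card_near(2)[OF st(2)] b_pos phi_pos[OF st(1)]
      by (intro ennreal_leI mult_right_mono) auto
    finally show "emeasure M E \<le> ennreal v" .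
    show "0 \<le> v" using b_pos phi_pos[OF st(1)] overlap_pos by (simp add: v_def)
    show "norm (spikes c u * indicator (qball d y r) u) \<le> m" if "u \<in> E" for u
      using that m(2) c by (auto simp: E_def spikes_on_ball s_def)
    show "spikes c u * indicator (qball d y r) u = 0" if "u \<notin> E" for u
    proof (cases "u \<in> qball d y r")
      case True
      then have "u \<notin> qball d (x i) 1" for i using that met[of u i] by (auto simp: E_def)
      then show ?thesis by (simp add: spikes_off_balls)
    qed simp
  qed (use q_less m in auto)
  moreover have "measure M (qball d y r) powr (1 / \<alpha> - real_of_ereal (1 / p) - 1 / q)
      \<le> (a * \<phi> r) powr (1 / \<alpha> - real_of_ereal (1 / p) - 1 / q)"
    using phi_bounds[OF r, of y] a_pos phi_pos[OF r] inverse_exponents \<theta>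
    by (intro powr_mono2') auto
  ultimately have "local_term d M q p \<alpha> r (spikes c) y
      \<le> ennreal ((a * \<phi> r) powr (1 / \<alpha> - real_of_ereal (1 / p) - 1 / q)) * ennreal (m * v powr (1 / q))"
    unfolding local_term_def by (intro mult_mono ennreal_leI) auto
  also have "\<dots> = ennreal (scale (real_of_ereal (1 / p)) r * m)"
    using m by (simp add: ennreal_mult[symmetric] scale_def v_def s_def t_def mult_ac)
  finally show ?thesis .
qed

text \<open>For \<open>r \<ge> 1\<close> the powers of \<open>\<phi> r\<close> cancel; for \<open>r < 1\<close> the remaining power
  \<open>\<phi> r powr (1 / \<alpha> - \<theta>)\<close> has a nonnegative exponent. The additional factor \<open>\<phi> (max r 1) powr \<theta>\<close> is the
  price of integrating over the points \<open>y\<close> near a given centre.\<close>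

lemma scale_bounded:
  assumes \<theta>: "0 \<le> \<theta>" "\<theta> \<le> 1 / \<alpha>"
  shows "\<exists>C\<ge>0. \<forall>r>0. scale \<theta> r * \<phi> (max r 1) powr \<theta> \<le> C"
proof -
  define C where "C = a powr (1 / \<alpha> - \<theta> - 1 / q) * (overlap * b) powr (1 / q)"
  have C: "0 \<le> C" by (simp add: C_def)
  have eq: "scale \<theta> r * \<phi> (max r 1) powr \<theta> =
      C * (\<phi> r powr (1 / \<alpha> - \<theta> - 1 / q) * \<phi> (max r 1) powr (1 / q - 1 / \<alpha> + \<theta>) * \<phi> (min r 1) powr (1 / q))"
    if "0 < r" for r
  proof -
    have "(1 - q / \<alpha>) * (1 / q) = 1 / q - 1 / \<alpha>" using q_less by (simp add: field_simps)
    then show ?thesis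
      using that phi_pos[of r] phi_pos[of "max r 1"] phi_pos[of "min r 1"] a_pos b_pos overlap_pos
      by (simp add: scale_def C_def powr_mult powr_powr powr_add mult_ac)
  qed
  show ?thesis
  proof (intro exI[of _ "C * \<phi> 1 powr (1 / q)"] conjI allI impI)
    show "0 \<le> C * \<phi> 1 powr (1 / q)" using C by simp
    fix r :: real assume r: "0 < r"
    have "\<phi> r powr (1 / \<alpha> - \<theta> - 1 / q) * \<phi> (max r 1) powr (1 / q - 1 / \<alpha> + \<theta>) * \<phi> (min r 1) powr (1 / q)
      \<le> \<phi> 1 powr (1 / q)"
    proof (cases "1 \<le> r")
      case True
      then show ?thesis using phi_pos[OF r] by (simp add: max_def min_def powr_add[symmetric])
    next
      case False
      have "\<phi> r powr (1 / \<alpha> - \<theta> - 1 / q) * \<phi> r powr (1 / q) = \<phi> r powr (1 / \<alpha> - \<theta>)"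
        using phi_pos[OF r] by (simp add: powr_add[symmetric])
      also have "\<dots> \<le> \<phi> 1 powr (1 / \<alpha> - \<theta>)"
        using False r \<theta> phi_pos[OF r] phi_le[of r 1] by (intro powr_mono2) auto
      finally have "\<phi> r powr (1 / \<alpha> - \<theta> - 1 / q) * \<phi> r powr (1 / q) * \<phi> 1 powr (1 / q - 1 / \<alpha> + \<theta>)
        \<le> \<phi> 1 powr (1 / \<alpha> - \<theta>) * \<phi> 1 powr (1 / q - 1 / \<alpha> + \<theta>)"
        by (intro mult_right_mono) auto
      also have "\<dots> = \<phi> 1 powr (1 / q)" using phi_pos[of 1] by (simp add: powr_add[symmetric])
      finally show ?thesis using False by (simp add: max_def min_def mult_ac)
    qed
    then show "scale \<theta> r * \<phi> (max r 1) powr \<theta> \<le> C * \<phi> 1 powr (1 / q)"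
      unfolding eq[OF r] using C by (intro mult_left_mono) auto
  qed
qed

lemma amalgam_norm_infinity:
  assumes c: "\<And>i. 0 \<le> c i" "\<And>i. c i \<le> 1"
  shows "amalgam_norm d M q \<infinity> \<alpha> (spikes c) < \<infinity>"
proof -
  obtain C where C: "0 \<le> C" "\<And>r. 0 < r \<Longrightarrow> scale 0 r * \<phi> (max r 1) powr 0 \<le> C"
    using scale_bounded[of 0] q_less by auto
  have "amalgam_norm d M q \<infinity> \<alpha> (spikes c) \<le> ennreal C"
    unfolding amalgam_norm_def
  proof (rule SUP_least)
    fix r :: real assume "r \<in> {0<..}"
    then have r: "0 < r" by simp
    show "amalgam_norm_at d M q \<infinity> \<alpha> r (spikes c) \<le> ennreal C"
      unfolding amalgam_norm_at_def
    proof (simp, rule SUP_least)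
      fix y
      have "local_term d M q \<infinity> \<alpha> r (spikes c) y \<le> ennreal (scale 0 r * 1)"
        using local_term_le[OF r, of c 1 y \<infinity>] c by simp
      also have "\<dots> \<le> ennreal C"
        using C(2)[OF r] phi_pos[of "max r 1"] by (intro ennreal_leI) (auto simp: less_max_iff_disj)
      finally show "local_term d M q \<infinity> \<alpha> r (spikes c) y \<le> ennreal C" .
    qed
  qed
  then show ?thesis by (rule le_less_trans) simp
qed

text \<open>The maximum of the heights near \<open>y\<close> is an honest term of the sum, attained at the least
  near index. Replacing the maximum by the sum makes the bound for \<open>local_term\<close> integrable in
  \<open>y\<close>, at no loss beyond \<open>c \<in> \<ell>\<^sup>P\<close>. With no index near \<open>y\<close>, the height is \<open>0\<close>.\<close>

lemma largest_near_height:
  assumes s: "1 \<le> s" and c: "decseq c" "\<And>i. 0 \<le> c i"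
  shows "\<exists>m\<ge>0. (\<forall>i\<in>near s y. c i \<le> m) \<and>
    ennreal (m powr P) \<le> (\<Sum>i. ennreal (c i powr P) * indicator (qball d (x i) (2 * \<kappa> * s)) y)"
proof (cases "near s y = {}")
  case True
  then show ?thesis by (intro exI[of _ 0]) auto
next
  case False
  define i0 where "i0 = (LEAST i. i \<in> near s y)"
  have i0: "i0 \<in> near s y" "\<And>i. i \<in> near s y \<Longrightarrow> i0 \<le> i"
    unfolding i0_def using False by (auto intro: LeastI Least_le)
  have "ennreal (c i0 powr P) = (\<Sum>i\<in>{i0}. ennreal (c i powr P) * indicator (qball d (x i) (2 * \<kappa> * s)) y)"
    using i0(1) by (simp add: near_def qball_def)
  also have "\<dots> \<le> (\<Sum>i. ennreal (c i powr P) * indicator (qball d (x i) (2 * \<kappa> * s)) y)"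
    by (rule sum_le_suminf) auto
  finally show ?thesis
    using i0(2) c by (intro exI[of _ "c i0"]) (auto dest: decseqD)
qed

text \<open>Integrating the pointwise bound, each spike contributes \<open>c i powr P\<close> times the measure of
  the points that it is near to, which doubling bounds by a multiple of \<open>\<phi> (max r 1)\<close>; after taking
  the \<open>P\<close>-th root, this is the factor that \<open>scale_bounded\<close> allows for.\<close>

lemma amalgam_norm_finite_exponent:
  assumes P: "\<alpha> < P" and c: "decseq c" "\<And>i. 0 \<le> c i" "summable (\<lambda>i. c i powr P)"
  shows "amalgam_norm d M q (ereal P) \<alpha> (spikes c) < \<infinity>"
proof -
  have P0: "0 < P" "0 \<le> 1 / P" "1 / P \<le> 1 / \<alpha>"
    using P q_less by (auto simp: divide_left_mono)
  have eP: "real_of_ereal (1 / ereal P) = 1 / P"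
    using P0 by (simp add: one_ereal_def)
  obtain C where C: "0 \<le> C" "\<And>r. 0 < r \<Longrightarrow> scale (1 / P) r * \<phi> (max r 1) powr (1 / P) \<le> C"
    using scale_bounded[OF P0(2,3)] by auto
  obtain D where D: "0 < D" "\<And>z r. 0 < r \<Longrightarrow> measure M (qball d z (2 * \<kappa> * r)) \<le> D * \<phi> r"
    using dilated_ball_measure[of "2 * \<kappa>"] by auto
  define S where "S = (\<Sum>i. c i powr P)"
  have S: "0 \<le> S" "(\<Sum>i. ennreal (c i powr P)) = ennreal S"
    unfolding S_def using c(3) by (auto intro!: suminf_nonneg suminf_ennreal2)
  have "amalgam_norm d M q (ereal P) \<alpha> (spikes c) \<le> ennreal (C * (S * D) powr (1 / P))"
    unfolding amalgam_norm_def
  proof (rule SUP_least)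
    fix r :: real assume "r \<in> {0<..}"
    then have r: "0 < r" by simp
    define s where "s = max r 1"
    define W where "W = scale (1 / P) r"
    have s: "1 \<le> s" by (simp add: s_def)
    have W: "0 \<le> W" by (simp add: W_def scale_def)
    have phi_s: "0 < \<phi> s" using s by (intro phi_pos) auto
    let ?sum = "\<lambda>y. \<Sum>i. ennreal (c i powr P) * indicator (qball d (x i) (2 * \<kappa> * s)) y"
    have pointwise: "ennreal_powr (local_term d M q (ereal P) \<alpha> r (spikes c) y) P
        \<le> ennreal (W powr P) * ?sum y" for y
    proof -
      obtain m where m: "0 \<le> m" "\<And>i. i \<in> near s y \<Longrightarrow> c i \<le> m" "ennreal (m powr P) \<le> ?sum y"
        using largest_near_height[OF s c(1,2), of y P] by blast
      have "local_term d M q (ereal P) \<alpha> r (spikes c) y \<le> ennreal (W * m)"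
        using local_term_le[OF r, of c m y "ereal P"] c m P0 eP by (simp add: s_def W_def)
      then have "ennreal_powr (local_term d M q (ereal P) \<alpha> r (spikes c) y) P
          \<le> ennreal_powr (ennreal (W * m)) P"
        using P0 by (intro ennreal_powr_mono)
      also have "\<dots> = ennreal (W powr P) * ennreal (m powr P)"
        using W m by (simp add: ennreal_powr_ennreal powr_mult flip: ennreal_mult)
      also have "\<dots> \<le> ennreal (W powr P) * ?sum y" using m by (intro mult_left_mono) auto
      finally show ?thesis .
    qed
    have "(\<integral>\<^sup>+ y. ennreal_powr (local_term d M q (ereal P) \<alpha> r (spikes c) y) P \<partial>M)
        \<le> (\<integral>\<^sup>+ y. ennreal (W powr P) * ?sum y \<partial>M)"
      using pointwise by (intro nn_integral_mono)
    also have "\<dots> = ennreal (W powr P) *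
        (\<Sum>i. ennreal (c i powr P) * emeasure M (qball d (x i) (2 * \<kappa> * s)))"
      by (simp add: nn_integral_cmult nn_integral_suminf nn_integral_cmult_indicator)
    also have "\<dots> \<le> ennreal (W powr P) * (\<Sum>i. ennreal (c i powr P) * ennreal (D * \<phi> s))"
      using D(2)[of s] s kappa(1)
      by (intro mult_left_mono suminf_le) (auto simp: ball_emeasure intro!: mult_left_mono ennreal_leI)
    also have "\<dots> = ennreal (W powr P * (S * (D * \<phi> s)))"
      using S D(1) phi_s by (simp add: ennreal_suminf_multc ennreal_mult)
    finally have "amalgam_norm_at d M q (ereal P) \<alpha> r (spikes c)
        \<le> ennreal_powr (ennreal (W powr P * (S * (D * \<phi> s)))) (1 / P)"
      unfolding amalgam_norm_at_def using P0 by (auto intro!: ennreal_powr_mono)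
    also have "\<dots> = ennreal ((W * \<phi> s powr (1 / P)) * (S * D) powr (1 / P))"
    proof -
      have "(W powr P * (S * (D * \<phi> s))) powr (1 / P) =
          (W powr P) powr (1 / P) * ((S * D) powr (1 / P) * \<phi> s powr (1 / P))"
        using S(1) D(1) phi_s by (simp add: powr_mult)
      also have "(W powr P) powr (1 / P) = W"
        using W P0(1) by (simp add: powr_powr)
      finally show ?thesis
        using S(1) D(1) phi_s by (simp add: ennreal_powr_ennreal mult_ac)
    qed
    also have "\<dots> \<le> ennreal (C * (S * D) powr (1 / P))"
      using C(2)[OF r] by (intro ennreal_leI mult_right_mono) (auto simp: W_def s_def)
    finally show "amalgam_norm_at d M q (ereal P) \<alpha> r (spikes c)
        \<le> ennreal (C * (S * D) powr (1 / P))" .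
  qed
  then show ?thesis by (rule le_less_trans) simp
qed

end

section \<open>The separating function\<close>

theorem theorem2p12:
  fixes d :: "'a \<Rightarrow> 'a \<Rightarrow> real" and M :: "'a measure"
    and q \<alpha> :: real and p :: ereal
    and \<phi> :: "real \<Rightarrow> real" and a b :: real
  assumes "standing_homogeneous_type_space d M"
    and "1 \<le> q" and "q < \<alpha>" and "ereal \<alpha> < p"
    and "mono_on {0..} \<phi>"
    and "0 < a" and "a \<le> b"
    and "\<And>x r. 0 < r \<Longrightarrow>
      a * \<phi> r \<le> measure M (qball d x r) \<and> measure M (qball d x r) \<le> b * \<phi> r"
  shows "amalgam_space d M q p \<alpha> - weak_Lebesgue_space M \<alpha> \<noteq> {}"
proof -
  interpret uniform_ball_measure d M \<phi> a b
    using assms by (intro uniform_ball_measure.intro uniform_ball_measure_axioms.intro)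
  obtain \<kappa> where \<kappa>: "1 \<le> \<kappa>" "\<And>u v w. d u v \<le> \<kappa> * (d u w + d w v)"
    using quasi_triangle by blast
  define \<eta> where "\<eta> = 1 - q / \<alpha>"
  have \<eta>: "0 < \<eta>" using assms(2,3) by (simp add: \<eta>_def)
  have "\<forall>j. \<exists>T\<ge>1. real (Suc j) powr (1 / \<eta>) \<le> \<phi> T" using phi_unbounded by blast
  then obtain T where T: "\<And>j. 1 \<le> T j" "\<And>j. real (Suc j) powr (1 / \<eta>) \<le> \<phi> (T j)"
    by metis
  have T': "real (Suc j) \<le> \<phi> (T j) powr (1 - q / \<alpha>)" for j
  proof -
    have "real (Suc j) = (real (Suc j) powr (1 / \<eta>)) powr \<eta>"
      using \<eta> by (simp add: powr_powr del: of_nat_Suc)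
    also have "\<dots> \<le> \<phi> (T j) powr \<eta>" using T(2)[of j] \<eta> by (intro powr_mono2) auto
    finally show ?thesis by (simp add: \<eta>_def)
  qed
  obtain x where x: "\<And>i j. i < j \<Longrightarrow> 4 * \<kappa>\<^sup>2 * T j \<le> d (x i) (x j)"
    using exists_sparse_sequence[of "\<lambda>j. 4 * \<kappa>\<^sup>2 * T j"] by blast
  interpret sparse_centres d M \<phi> a b \<kappa> q \<alpha> T x
    using \<kappa> assms(2,3) T(1) T' x by unfold_locales auto
  \<comment> \<open>Heights \<open>c\<close> in \<open>\<ell>\<^sup>p\<close> but not in weak \<open>\<ell>\<^sup>\<alpha>\<close>: the exponent \<open>\<beta>\<close> must lie strictly in between.\<close>
  obtain \<beta> where \<beta>: "\<alpha> < \<beta>" "ereal \<beta> < p"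
    using ereal_dense2[OF assms(4)] by auto
  define c where "c i = real (Suc i) powr - (1 / \<beta>)" for i
  have \<beta>0: "0 < \<beta>" "1 / \<beta> < 1 / \<alpha>"
    using assms(2,3) \<beta>(1) by (auto simp: divide_strict_left_mono)
  have c: "decseq c" "\<And>i. 0 \<le> c i" "\<And>i. c i \<le> 1"
  proof -
    show dec: "decseq c"
      unfolding decseq_def c_def using \<beta>0 by (auto intro!: powr_mono2')
    show "0 \<le> c i" for i by (simp add: c_def)
    show "c i \<le> 1" for i using decseqD[OF dec, of 0 i] by (simp add: c_def)
  qed
  have "amalgam_norm d M q p \<alpha> (spikes c) < \<infinity>"
  proof (cases p)
    case (real P)
    have "summable (\<lambda>i. c i powr P)"
    proof -
      have "P / \<beta> > 1" using \<beta> \<beta>0 real by simp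
      then have "summable (\<lambda>i. real i powr - (P / \<beta>))" by (simp add: summable_real_powr_iff)
      then have "summable (\<lambda>i. real (Suc i) powr - (P / \<beta>))" by (subst summable_Suc_iff)
      then show ?thesis by (simp add: c_def powr_powr)
    qed
    then show ?thesis
      unfolding real using assms(4) real c by (intro amalgam_norm_finite_exponent) auto
  next
    case PInf
    then show ?thesis using amalgam_norm_infinity[of c] c by simp
  next
    case MInf
    then show ?thesis using assms(4) by simp
  qed
  then have "spikes c \<in> amalgam_space d M q p \<alpha>"
    by (simp add: amalgam_space_def spikes_measurable)
  moreover have "spikes c \<notin> weak_Lebesgue_space M \<alpha>"
  proof (rule not_in_weak_Lebesgue_space)
    let ?m = "a * \<phi> 1"
    show m: "0 < ?m" using a_pos phi_pos[of 1] by simp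
    show "ennreal ?m \<le> emeasure M (qball d (x i) 1)" for i
      using phi_bounds[of 1 "x i"] by (simp add: ball_emeasure ennreal_leI)
    show "\<exists>n. Z < (real (Suc n) * ?m) powr (1 / \<alpha>) * c n" for Z
    proof -
      define \<delta> where "\<delta> = 1 / \<alpha> - 1 / \<beta>"
      define A where "A = ?m powr (1 / \<alpha>)"
      have pos: "0 < \<delta>" "0 < A" using \<beta>0 m by (auto simp: \<delta>_def A_def)
      \<comment> \<open>The quantity in question equals \<open>A * real (Suc n) powr \<delta>\<close> with \<open>\<delta> > 0\<close>.\<close>
      obtain n where n: "(\<bar>Z\<bar> / A + 1) powr (1 / \<delta>) < real n" using reals_Archimedean2 by blast
      have "\<bar>Z\<bar> / A + 1 = ((\<bar>Z\<bar> / A + 1) powr (1 / \<delta>)) powr \<delta>"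
        using pos by (simp add: powr_powr)
      also have "\<dots> \<le> real (Suc n) powr \<delta>" using n pos by (intro powr_mono2) auto
      finally have "Z / A < real (Suc n) powr \<delta>"
        using pos by (smt (verit) divide_right_mono abs_ge_self)
      then have "Z < A * real (Suc n) powr \<delta>" using pos by (simp add: pos_divide_less_eq mult.commute)
      also have "\<dots> = (real (Suc n) * ?m) powr (1 / \<alpha>) * c n"
        using m by (simp add: A_def c_def \<delta>_def powr_mult powr_diff powr_minus_divide del: of_nat_Suc)
      finally show ?thesis by blast
    qed
  qed (use c disjoint_unit_balls spikes_measurable in \<open>auto simp: spikes_on_ball\<close>)
  ultimately show ?thesis by blast
qed

end
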